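(* Let $w_1=\sqrt2\,\xi$, $w_2=\xi^2$ for $\xi=x+iy\in\mathbb{C}$ (the holomorphic Veronese solution, with vector $f=(1,\sqrt2\,\xi,\xi^2)$, of the $\mathbb{C}P^2$ sigma model). Then the eight real Weierstrass 1-forms $dX_1,\dots,dX_8$ given in the context integrate, up to additive constants, to the components of a surface in $\mathbb{R}^8$: $$X_1=\frac{\sqrt2\,x(x^2+y^2)}{(1+x^2+y^2)^2},\quad X_2=\frac{\sqrt2\,y(x^2+y^2)}{(1+x^2+y^2)^2},\quad X_3=-\frac{(x^2+y^2)(x^2+y^2-2)}{2(1+x^2+y^2)^2},$$ $$X_4=-\sqrt3\,\frac{(x^2+y^2)(x^2+y^2+2)}{2(1+x^2+y^2)^2},\quad X_5=\frac{\sqrt2\,y}{(1+x^2+y^2)^2},\quad X_6=\frac{2xy}{(1+x^2+y^2)^2},$$ $$X_7=-\frac{\sqrt2\,x}{(1+x^2+y^2)^2},\quad X_8=\frac{-x^2+y^2}{(1+x^2+y^2)^2},$$ and these components satisfy $$4X_1^2+4X_2^2+4X_3^2+\frac{2}{\sqrt3}X_4+X_5^2+X_6^2+X_7^2+X_8^2=0 .$$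
   Context: $\partial=\partial/\partial\xi$ (Wirtinger derivative) and "c.c." denotes the complex conjugate of the preceding $[\dots]d\xi$ term. For functions $w_1,w_2$ put $A=1+|w_1|^2+|w_2|^2$. The Weierstrass 1-forms (components of the generalized Weierstrass immersion into $su(3)\simeq\mathbb{R}^8$) are $dX_1=\frac{1}{2A^2}\big([(w_2^2-w_1^2)(\bar w_1\partial\bar w_2-\bar w_2\partial\bar w_1)-(\bar w_2^2-\bar w_1^2)(w_1\partial w_2-w_2\partial w_1)-w_2\partial\bar w_1+\bar w_2\partial w_1-w_1\partial\bar w_2+\bar w_1\partial w_2]d\xi+\text{c.c.}\big)$, $dX_2=\frac{i}{2A^2}\big([(w_1^2+w_2^2)(\bar w_2\partial\bar w_1-\bar w_1\partial\bar w_2)+(\bar w_1^2+\bar w_2^2)(w_2\partial w_1-w_1\partial w_2)+w_2\partial\bar w_1+\bar w_2\partial w_1-w_1\partial\bar w_2-\bar w_1\partial w_2]d\xi-\text{c.c.}\big)$, $dX_3=\frac{1}{2A^2}\big([w_2\partial\bar w_2-w_1\partial\bar w_1-\bar w_2\partial w_2+\bar w_1\partial w_1+2|w_1|^2(w_2\partial\bar w_2-\bar w_2\partial w_2)-2|w_2|^2(w_1\partial\bar w_1-\bar w_1\partial w_1)]d\xi+\text{c.c.}\big)$, $dX_4=\frac{\sqrt3}{2A^2}\big([w_1\partial\bar w_1+w_2\partial\bar w_2-\bar w_1\partial w_1-\bar w_2\partial w_2]d\xi+\text{c.c.}\big)$, $dX_5=-\frac{i}{2A^2}\big([(1+\bar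 w_1^2+|w_2|^2)\partial w_1+(1+w_1^2+|w_2|^2)\partial\bar w_1+(w_2\partial\bar w_2-\bar w_2\partial w_2)(w_1-\bar w_1)]d\xi-\text{c.c.}\big)$, $dX_6=-\frac{i}{2A^2}\big([(1+\bar w_2^2+|w_1|^2)\partial w_2+(1+w_2^2+|w_1|^2)\partial\bar w_2+(w_1\partial\bar w_1-\bar w_1\partial w_1)(w_2-\bar w_2)]d\xi-\text{c.c.}\big)$, $dX_7=\frac{1}{2A^2}\big([(1-w_1^2+|w_2|^2)\partial\bar w_1-(1-\bar w_1^2+|w_2|^2)\partial w_1+(\bar w_2\partial w_2-w_2\partial\bar w_2)(w_1+\bar w_1)]d\xi+\text{c.c.}\big)$, $dX_8=\frac{1}{2A^2}\big([(1-w_2^2+|w_1|^2)\partial\bar w_2-(1-\bar w_2^2+|w_1|^2)\partial w_2+(\bar w_1\partial w_1-w_1\partial\bar w_1)(w_2+\bar w_2)]d\xi+\text{c.c.}\big)$. *)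

theory Defs
  imports "HOL-Analysis.Analysis"
begin

text \<open>The Wirtinger derivative \<open>\<partial> = (\<partial>\<^sub>x - \<i> \<partial>\<^sub>y) / 2\<close> in \<open>\<xi> = x + \<i> y\<close>; the partial derivatives are
  values of the real Frechet derivative. Meaningful where \<open>f\<close> is real-differentiable.\<close>

definition wirtinger :: "(complex \<Rightarrow> complex) \<Rightarrow> complex \<Rightarrow> complex" where
  "wirtinger f \<xi> =
     (frechet_derivative f (at \<xi>) 1 - \<i> * frechet_derivative f (at \<xi>) \<i>) / 2"

text \<open>A complex-valued 1-form on the plane is a function of a point \<open>\<xi>\<close> and a tangent vector \<open>v\<close>, with
  \<open>d\<xi>\<close> sending \<open>v\<close> to \<open>v\<close>. The next two functions are \<open>[B] d\<xi> + c.c.\<close> and \<open>[B] d\<xi> - c.c.\<close>,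
  evaluated at \<open>v\<close>.\<close>

definition plus_cc :: "complex \<Rightarrow> complex \<Rightarrow> complex" where
  "plus_cc B v = B * v + cnj (B * v)"

definition minus_cc :: "complex \<Rightarrow> complex \<Rightarrow> complex" where
  "minus_cc B v = B * v - cnj (B * v)"

text \<open>\<open>weierstrass_form f1 f2 k \<xi> v\<close> is \<open>dX\<^sub>k\<close>, for \<open>k = 1, \<dots>, 8\<close> and \<open>(w\<^sub>1, w\<^sub>2) = (f1, f2)\<close>, at the point
  \<open>\<xi>\<close> on the tangent vector \<open>v\<close>. In the body, \<open>c\<^sub>j\<close> is the conjugate of \<open>w\<^sub>j\<close>, \<open>p\<^sub>j = \<partial> w\<^sub>j\<close> and
  \<open>q\<^sub>j = \<partial> c\<^sub>j\<close>, all at \<open>\<xi>\<close>.\<close>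

definition weierstrass_form ::
  "(complex \<Rightarrow> complex) \<Rightarrow> (complex \<Rightarrow> complex) \<Rightarrow> nat \<Rightarrow> complex \<Rightarrow> complex \<Rightarrow> complex" where
  "weierstrass_form f1 f2 k \<xi> v =
    (let w1 = f1 \<xi>; w2 = f2 \<xi>; c1 = cnj w1; c2 = cnj w2;
         p1 = wirtinger f1 \<xi>; p2 = wirtinger f2 \<xi>;
         q1 = wirtinger (\<lambda>\<zeta>. cnj (f1 \<zeta>)) \<xi>; q2 = wirtinger (\<lambda>\<zeta>. cnj (f2 \<zeta>)) \<xi>;
         n1 = complex_of_real ((cmod w1)\<^sup>2); n2 = complex_of_real ((cmod w2)\<^sup>2);
         A = 1 + n1 + n2
     in
     if k = 1 then
       1 / (2 * A\<^sup>2) * plus_cc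
         ((w2\<^sup>2 - w1\<^sup>2) * (c1 * q2 - c2 * q1) - (c2\<^sup>2 - c1\<^sup>2) * (w1 * p2 - w2 * p1)
          - w2 * q1 + c2 * p1 - w1 * q2 + c1 * p2) v
     else if k = 2 then
       \<i> / (2 * A\<^sup>2) * minus_cc
         ((w1\<^sup>2 + w2\<^sup>2) * (c2 * q1 - c1 * q2) + (c1\<^sup>2 + c2\<^sup>2) * (w2 * p1 - w1 * p2)
          + w2 * q1 + c2 * p1 - w1 * q2 - c1 * p2) v
     else if k = 3 then
       1 / (2 * A\<^sup>2) * plus_cc
         (w2 * q2 - w1 * q1 - c2 * p2 + c1 * p1
          + 2 * n1 * (w2 * q2 - c2 * p2) - 2 * n2 * (w1 * q1 - c1 * p1)) v
     else if k = 4 then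
       complex_of_real (sqrt 3) / (2 * A\<^sup>2) * plus_cc
         (w1 * q1 + w2 * q2 - c1 * p1 - c2 * p2) v
     else if k = 5 then
       - \<i> / (2 * A\<^sup>2) * minus_cc
         ((1 + c1\<^sup>2 + n2) * p1 + (1 + w1\<^sup>2 + n2) * q1 + (w2 * q2 - c2 * p2) * (w1 - c1)) v
     else if k = 6 then
       - \<i> / (2 * A\<^sup>2) * minus_cc
         ((1 + c2\<^sup>2 + n1) * p2 + (1 + w2\<^sup>2 + n1) * q2 + (w1 * q1 - c1 * p1) * (w2 - c2)) v
     else if k = 7 then
       1 / (2 * A\<^sup>2) * plus_cc
         ((1 - w1\<^sup>2 + n2) * q1 - (1 - c1\<^sup>2 + n2) * p1 + (c2 * p2 - w2 * q2) * (w1 + c1)) v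
     else if k = 8 then
       1 / (2 * A\<^sup>2) * plus_cc
         ((1 - w2\<^sup>2 + n1) * q2 - (1 - c2\<^sup>2 + n1) * p2 + (c1 * p1 - w1 * q1) * (w2 + c2)) v
     else 0)"

definition veronese_surface :: "nat \<Rightarrow> real \<Rightarrow> real \<Rightarrow> real" where
  "veronese_surface k x y =
    (if k = 1 then sqrt 2 * x * (x\<^sup>2 + y\<^sup>2) / (1 + x\<^sup>2 + y\<^sup>2)\<^sup>2
     else if k = 2 then sqrt 2 * y * (x\<^sup>2 + y\<^sup>2) / (1 + x\<^sup>2 + y\<^sup>2)\<^sup>2
     else if k = 3 then - ((x\<^sup>2 + y\<^sup>2) * (x\<^sup>2 + y\<^sup>2 - 2) / (2 * (1 + x\<^sup>2 + y\<^sup>2)\<^sup>2))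
     else if k = 4 then - (sqrt 3 * ((x\<^sup>2 + y\<^sup>2) * (x\<^sup>2 + y\<^sup>2 + 2) / (2 * (1 + x\<^sup>2 + y\<^sup>2)\<^sup>2)))
     else if k = 5 then sqrt 2 * y / (1 + x\<^sup>2 + y\<^sup>2)\<^sup>2
     else if k = 6 then 2 * x * y / (1 + x\<^sup>2 + y\<^sup>2)\<^sup>2
     else if k = 7 then - (sqrt 2 * x / (1 + x\<^sup>2 + y\<^sup>2)\<^sup>2)
     else if k = 8 then (- x\<^sup>2 + y\<^sup>2) / (1 + x\<^sup>2 + y\<^sup>2)\<^sup>2
     else 0)"

text \<open>A real function \<open>Y\<close> is a primitive of a 1-form \<open>\<omega>\<close> if \<open>dY = \<omega>\<close> on the whole plane. Since \<open>\<omega>\<close> is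
  complex-valued by type, \<open>Y\<close> is embedded into \<open>\<complex>\<close>, so having a primitive forces \<open>\<omega>\<close> to be real.\<close>

definition is_primitive :: "(complex \<Rightarrow> complex \<Rightarrow> complex) \<Rightarrow> (complex \<Rightarrow> real) \<Rightarrow> bool" where
  "is_primitive \<omega> Y \<longleftrightarrow> (\<forall>\<xi>. ((\<lambda>\<zeta>. complex_of_real (Y \<zeta>)) has_derivative \<omega> \<xi>) (at \<xi>))"

end

theory Submission
  imports Defs
begin

text \<open>Since \<open>w\<^sub>1\<close> and \<open>w\<^sub>2\<close> are holomorphic, all terms containing \<open>\<partial>\<close> of a conjugate vanish, and
  \<open>A = (1 + |\<xi>|\<^sup>2)\<^sup>2\<close>. Writing \<open>D = 1 + |\<xi>|\<^sup>2\<close>, each component is \<open>P / D\<^sup>2\<close> with \<open>P\<close> polynomial and each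
  form is \<open>Q / D\<^sup>4\<close>, so the claim \<open>dX\<^sub>k = d (P / D\<^sup>2)\<close> becomes a polynomial identity
  \<open>Q = D (D dP - 2 P dD)\<close>. Primitives on the connected plane are unique up to constants.\<close>

section \<open>Uniqueness of primitives up to a constant\<close>

lemma is_primitive_unique:
  assumes F: "is_primitive \<omega> F"
  shows "is_primitive \<omega> Y \<longleftrightarrow> (\<exists>c. \<forall>\<xi>. Y \<xi> = F \<xi> + c)"
proof
  assume Y: "is_primitive \<omega> Y"
  have "((\<lambda>\<zeta>. complex_of_real (Y \<zeta>) - complex_of_real (F \<zeta>)) has_derivative (\<lambda>v. 0))
          (at \<xi> within UNIV)" for \<xi>
    using has_derivative_diff[of "\<lambda>\<zeta>. complex_of_real (Y \<zeta>)" "\<omega> \<xi>" "at \<xi>"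
        "\<lambda>\<zeta>. complex_of_real (F \<zeta>)" "\<omega> \<xi>"] F Y
    unfolding is_primitive_def by simp
  from has_derivative_zero_constant[OF convex_UNIV this]
  obtain c where c: "\<forall>\<xi>\<in>UNIV. complex_of_real (Y \<xi>) - complex_of_real (F \<xi>) = c" ..
  \<comment> \<open>The constant \<open>c\<close> is complex because the primitives were embedded
    into the complex numbers; its real part is the constant sought.\<close>
  have "Y \<xi> = F \<xi> + Re c" for \<xi>
    using arg_cong[OF bspec[OF c UNIV_I], of Re \<xi>] by simp
  then show "\<exists>c. \<forall>\<xi>. Y \<xi> = F \<xi> + c" by blast
next
  assume "\<exists>c. \<forall>\<xi>. Y \<xi> = F \<xi> + c"
  then obtain c where "\<And>\<xi>. Y \<xi> = F \<xi> + c" by blast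
  then have "Y = (\<lambda>\<xi>. F \<xi> + c)" by (rule ext)
  with F show "is_primitive \<omega> Y"
    unfolding is_primitive_def by (simp add: has_derivative_add_const)
qed

section \<open>Wirtinger derivatives of \<open>w1\<close>, \<open>w2\<close> and their
  conjugates\<close>

lemma wirtinger_eq:
  assumes "(f has_derivative f') (at \<xi>)"
  shows "wirtinger f \<xi> = (f' 1 - \<i> * f' \<i>) / 2"
  unfolding wirtinger_def frechet_derivative_at[OF assms, symmetric] ..

text \<open>The derivative \<open>D * v\<close> is complex linear, so
  \<open>- \<i> * (D * \<i>)\<close> is a second copy of \<open>D\<close>; composed with
  \<open>cnj\<close> it becomes antilinear, and the two terms cancel.\<close>

lemma wirtinger_field:
  assumes "(f has_field_derivative D) (at \<xi>)"
  shows "wirtinger f \<xi> = D" and "wirtinger (\<lambda>\<zeta>. cnj (f \<zeta>)) \<xi> = 0"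
proof -
  have f: "(f has_derivative (\<lambda>v. D * v)) (at \<xi>)"
    using assms by (simp add: has_field_derivative_def)
  show "wirtinger f \<xi> = D"
    by (simp add: wirtinger_eq[OF f] algebra_simps)
  show "wirtinger (\<lambda>\<zeta>. cnj (f \<zeta>)) \<xi> = 0"
    by (simp add: wirtinger_eq[OF has_derivative_cnj[OF f]] algebra_simps)
qed

lemma wirtinger_scaled_id:
  "wirtinger (\<lambda>\<xi>. a * \<xi>) \<xi> = a" "wirtinger (\<lambda>\<zeta>. cnj (a * \<zeta>)) \<xi> = 0"
proof -
  have "((\<lambda>\<xi>. a * \<xi>) has_field_derivative a) (at \<xi>)"
    using DERIV_cmult_Id by blast
  from wirtinger_field[OF this]
  show "wirtinger (\<lambda>\<xi>. a * \<xi>) \<xi> = a" "wirtinger (\<lambda>\<zeta>. cnj (a * \<zeta>)) \<xi> = 0" .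
qed

lemma wirtinger_square:
  "wirtinger (\<lambda>\<xi>. \<xi>\<^sup>2) \<xi> = 2 * \<xi>" "wirtinger (\<lambda>\<zeta>. cnj (\<zeta>\<^sup>2)) \<xi> = 0"
proof -
  have "((\<lambda>\<xi>. \<xi>\<^sup>2) has_field_derivative 2 * \<xi>) (at \<xi>)"
    using DERIV_power[OF DERIV_ident, of 2 \<xi> UNIV] by simp
  from wirtinger_field[OF this]
  show "wirtinger (\<lambda>\<xi>. \<xi>\<^sup>2) \<xi> = 2 * \<xi>" "wirtinger (\<lambda>\<zeta>. cnj (\<zeta>\<^sup>2)) \<xi> = 0" .
qed

section \<open>Real expressions for the norms and the forms\<close>

text \<open>The coefficients 1, 2, 1 of the squared norms make \<open>A\<close> a perfect square.
  Everything is written as \<open>complex_of_real\<close> of a real term so that the rules for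
  \<open>plus_cc\<close> and \<open>minus_cc\<close> apply to \<open>A\<close>.\<close>

lemma veronese_norm:
  assumes "t * t = 2"
  shows "complex_of_real ((cmod (complex_of_real t * Complex x y))\<^sup>2) = complex_of_real (2 * (x\<^sup>2 + y\<^sup>2))"
    and "complex_of_real ((cmod ((Complex x y)\<^sup>2))\<^sup>2) = complex_of_real ((x\<^sup>2 + y\<^sup>2)\<^sup>2)"
    and "1 + complex_of_real (2 * (x\<^sup>2 + y\<^sup>2)) + complex_of_real ((x\<^sup>2 + y\<^sup>2)\<^sup>2)
      = complex_of_real ((1 + x\<^sup>2 + y\<^sup>2)\<^sup>2)"
proof -
  have "\<bar>t\<bar>\<^sup>2 = 2" using assms by (simp add: power2_eq_square)
  then have "(cmod (complex_of_real t * Complex x y))\<^sup>2 = 2 * (x\<^sup>2 + y\<^sup>2)"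
    by (simp only: norm_mult norm_of_real power_mult_distrib cmod_power2 complex.sel)
  then show "complex_of_real ((cmod (complex_of_real t * Complex x y))\<^sup>2) = complex_of_real (2 * (x\<^sup>2 + y\<^sup>2))"
    by (rule arg_cong)
  show "complex_of_real ((cmod ((Complex x y)\<^sup>2))\<^sup>2) = complex_of_real ((x\<^sup>2 + y\<^sup>2)\<^sup>2)"
    by (simp only: norm_power cmod_power2 complex.sel)
  show "1 + complex_of_real (2 * (x\<^sup>2 + y\<^sup>2)) + complex_of_real ((x\<^sup>2 + y\<^sup>2)\<^sup>2)
      = complex_of_real ((1 + x\<^sup>2 + y\<^sup>2)\<^sup>2)"
    by (simp add: power2_eq_square algebra_simps)
qed

text \<open>Adding the conjugate leaves twice the real part, subtracting it leaves
  \<open>2 * \<i>\<close> times the imaginary part. This rule and the next three cover the four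
  prefactors of the Weierstrass forms and show that each form is real.\<close>

lemma plus_cc_eq: "1 / (2 * (complex_of_real d)\<^sup>2) * plus_cc B v = complex_of_real (Re (B * v) / d\<^sup>2)"
  unfolding plus_cc_def complex_add_cnj by (simp del: times_complex.sel)

lemma minus_cc_eq: "\<i> / (2 * (complex_of_real d)\<^sup>2) * minus_cc B v = complex_of_real (- Im (B * v) / d\<^sup>2)"
  unfolding minus_cc_def complex_diff_cnj by (simp del: times_complex.sel add: algebra_simps)

lemma scaled_plus_cc_eq:
  "complex_of_real c / (2 * (complex_of_real d)\<^sup>2) * plus_cc B v = complex_of_real (c * Re (B * v) / d\<^sup>2)"
  unfolding plus_cc_def complex_add_cnj by (simp del: times_complex.sel)

lemma neg_minus_cc_eq:
  "- \<i> / (2 * (complex_of_real d)\<^sup>2) * minus_cc B v = complex_of_real (Im (B * v) / d\<^sup>2)"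
  unfolding minus_cc_def complex_diff_cnj by (simp del: times_complex.sel add: algebra_simps)

section \<open>Differentials of quotients by the squared denominator\<close>

text \<open>The quotient rule gives a denominator \<open>D ^ 4\<close>, from which one factor
  \<open>D\<close> cancels. The coefficient 4 is the exponent 2 times the 2 in
  \<open>dD = 2 * (x * Re v + y * Im v)\<close>.\<close>

lemma has_derivative_over_square:
  fixes N :: "complex \<Rightarrow> real"
  assumes N: "(N has_derivative N') (at \<xi>)"
    and "Re \<xi> = x" "Im \<xi> = y"
  shows "((\<lambda>\<zeta>. N \<zeta> / (1 + (Re \<zeta>)\<^sup>2 + (Im \<zeta>)\<^sup>2)\<^sup>2) has_derivative
           (\<lambda>v. (N' v * (1 + x\<^sup>2 + y\<^sup>2) - 4 * N \<xi> * (x * Re v + y * Im v))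
              / (1 + x\<^sup>2 + y\<^sup>2) ^ 3)) (at \<xi>)"
proof -
  define D where "D = (\<lambda>\<zeta>. 1 + (Re \<zeta>)\<^sup>2 + (Im \<zeta>)\<^sup>2)"
  have "1 + x\<^sup>2 + y\<^sup>2 > 0" by (simp add: add_pos_nonneg)
  then have D0: "D \<xi> \<noteq> 0" using assms(2,3) unfolding D_def by simp
  have D: "(D has_derivative (\<lambda>v. 2 * (x * Re v + y * Im v))) (at \<xi>)"
    unfolding D_def assms(2,3)[symmetric]
    by (auto intro!: derivative_eq_intros simp: fun_eq_iff algebra_simps)
  have "((\<lambda>\<zeta>. N \<zeta> / (D \<zeta>)\<^sup>2) has_derivative
      (\<lambda>v. (N' v * D \<xi> - 4 * N \<xi> * (x * Re v + y * Im v)) / D \<xi> ^ 3)) (at \<xi>)"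
  proof (rule has_derivative_eq_rhs[OF has_derivative_divide'[OF N has_derivative_power[OF D, of 2]]])
    show "D \<xi> ^ 2 \<noteq> 0" using D0 by simp
    \<comment> \<open>The left side copies the shape that the division and power rules produce, with
      \<open>e\<close> for half of \<open>dD\<close>.\<close>
    have "(a * d\<^sup>2 - n * (of_nat 2 * (2 * e) * d ^ (2 - 1))) / (d\<^sup>2 * d\<^sup>2) = (a * d - 4 * n * e) / d ^ 3"
      if "d \<noteq> 0" for a d n e :: real
    proof -
      have *: "a * d\<^sup>2 - n * (of_nat 2 * (2 * e) * d ^ (2 - 1)) = d * (a * d - 4 * n * e)"
        "d\<^sup>2 * d\<^sup>2 = d * d ^ 3"
        by (simp_all add: power2_eq_square power3_eq_cube algebra_simps)
      show ?thesis unfolding * using that by simp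
    qed
    note cancel = this[OF D0]
    show "(\<lambda>h. (N' h * (D \<xi>)\<^sup>2 - N \<xi> * (of_nat 2 * (2 * (x * Re h + y * Im h)) * D \<xi> ^ (2 - 1))) /
         ((D \<xi>)\<^sup>2 * (D \<xi>)\<^sup>2)) = (\<lambda>v. (N' v * D \<xi> - 4 * N \<xi> * (x * Re v + y * Im v)) / D \<xi> ^ 3)"
      by (rule ext) (rule cancel)
  qed
  then show ?thesis
    unfolding D_def assms(2,3) .
qed

text \<open>The fraction in the third premise is kept expanded by \<open>D\<close>, so that its
  denominator is literally \<open>A\<^sup>2\<close> with \<open>A = D\<^sup>2\<close>, as in the
  forms; comparing with a form then only involves numerators.\<close>

lemma is_primitive_over_square:
  fixes P :: "real \<Rightarrow> real \<Rightarrow> real"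
  assumes Y: "\<And>x y. Y x y = P x y / (1 + x\<^sup>2 + y\<^sup>2)\<^sup>2"
    and P: "\<And>\<xi>. ((\<lambda>\<zeta>. P (Re \<zeta>) (Im \<zeta>)) has_derivative
                    (\<lambda>v. P' (Re \<xi>) (Im \<xi>) (Re v) (Im v))) (at \<xi>)"
    and \<omega>: "\<And>x y a b. \<omega> (Complex x y) (Complex a b) = complex_of_real
      ((1 + x\<^sup>2 + y\<^sup>2) * (P' x y a b * (1 + x\<^sup>2 + y\<^sup>2) - 4 * P x y * (x * a + y * b))
        / ((1 + x\<^sup>2 + y\<^sup>2)\<^sup>2)\<^sup>2)"
  shows "is_primitive \<omega> (\<lambda>\<zeta>. Y (Re \<zeta>) (Im \<zeta>))"
  unfolding is_primitive_def
proof
  fix \<xi>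
  obtain x y where \<xi>: "\<xi> = Complex x y" by (cases \<xi>)
  define d where "d = 1 + x\<^sup>2 + y\<^sup>2"
  have "d > 0" unfolding d_def by (simp add: add_pos_nonneg)
  then have cancel: "d * r / (d\<^sup>2)\<^sup>2 = r / d ^ 3" for r
    by (simp add: eval_nat_numeral)
  have "complex_of_real ((P' x y (Re v) (Im v) * d - 4 * P x y * (x * Re v + y * Im v)) / d ^ 3)
      = \<omega> \<xi> v" for v
    using \<omega>[of x y "Re v" "Im v"] unfolding \<xi> d_def[symmetric]
    by (simp only: complex.collapse cancel)
  then have "(\<lambda>v. complex_of_real
      ((P' x y (Re v) (Im v) * d - 4 * P x y * (x * Re v + y * Im v)) / d ^ 3)) = \<omega> \<xi>" ..
  then show "((\<lambda>\<zeta>. complex_of_real (Y (Re \<zeta>) (Im \<zeta>))) has_derivative \<omega> \<xi>) (at \<xi>)"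
    using has_derivative_of_real[where 'a = complex,
        OF has_derivative_over_square[OF P refl refl, of \<xi>]]
    by (simp only: Y \<xi> d_def complex.sel)
qed

section \<open>The eight components as primitives\<close>

text \<open>Right-nested products hide the redex \<open>t * t\<close> from the rewrite rule
  \<open>t * t = 2\<close>.\<close>

lemma mult_self_absorb: "t * (t * r) = 2 * r" if "t * t = 2" for t r :: real
  using that by (simp add: mult.assoc[symmetric])

text \<open>The facts on numerals let \<open>simp only\<close> select the branch for the given
  \<open>k\<close> without disturbing the fractions.\<close>

lemmas veronese_form_simps =
  weierstrass_form_def Let_def wirtinger_scaled_id wirtinger_square
  plus_cc_eq minus_cc_eq scaled_plus_cc_eq neg_minus_cc_eq of_real_eq_iff
  if_True if_False refl numeral_eq_iff one_eq_numeral_iff numeral_eq_one_iff num.distinct num.inject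

text \<open>\<open>sqrt 2\<close> is abstracted to \<open>t\<close> so that simplification meets it only as a polynomial variable
  subject to \<open>t * t = 2\<close>.\<close>

lemma veronese_primitive:
  assumes t: "t * t = 2" "t = sqrt 2" and k: "k \<in> {1..8}"
  shows "is_primitive (weierstrass_form (\<lambda>\<xi>. complex_of_real t * \<xi>) (\<lambda>\<xi>. \<xi>\<^sup>2) k)
           (\<lambda>\<zeta>. veronese_surface k (Re \<zeta>) (Im \<zeta>))"
proof -
  note poly_simps = power2_eq_square field_simps t(1) mult_self_absorb[OF t(1)]
  consider "k = 1" | "k = 2" | "k = 3" | "k = 4" | "k = 5" | "k = 6" | "k = 7" | "k = 8"
    using k by fastforce
  then show ?thesis
  proof cases
    case 1
    show ?thesis
      unfolding \<open>k = 1\<close>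
    \<comment> \<open>In all eight cases \<open>P\<close> is the numerator of the component over
      \<open>D\<^sup>2\<close>, and \<open>P'\<close> is its differential at \<open>(x, y)\<close>
      along \<open>(a, b)\<close>.\<close>
    proof (rule is_primitive_over_square[where
          P = "\<lambda>x y. t * x * (x\<^sup>2 + y\<^sup>2)" and
          P' = "\<lambda>x y a b. t * (a * (x\<^sup>2 + y\<^sup>2) + 2 * x * (x * a + y * b))"], goal_cases)
      case 1
      show ?case by (simp add: veronese_surface_def t(2))
    next
      case 2
      show ?case by (auto intro!: derivative_eq_intros simp: fun_eq_iff poly_simps)
    next
      case 3
      show ?case
        \<comment> \<open>Both sides become fractions with the same denominator, so congruence of
          division leaves a polynomial identity in \<open>x\<close>, \<open>y\<close>,
          \<open>a\<close>, \<open>b\<close> and \<open>t\<close>.\<close>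
        by (simp only: veronese_norm[OF t(1)] veronese_form_simps,
            rule arg_cong2[of _ _ _ _ "(/)", OF _ refl])
          (simp add: poly_simps)
    qed
  next
    case 2
    show ?thesis
      unfolding \<open>k = 2\<close>
    proof (rule is_primitive_over_square[where
          P = "\<lambda>x y. t * y * (x\<^sup>2 + y\<^sup>2)" and
          P' = "\<lambda>x y a b. t * (b * (x\<^sup>2 + y\<^sup>2) + 2 * y * (x * a + y * b))"], goal_cases)
      case 1
      show ?case by (simp add: veronese_surface_def t(2))
    next
      case 2
      show ?case by (auto intro!: derivative_eq_intros simp: fun_eq_iff poly_simps)
    next
      case 3
      show ?case
        by (simp only: veronese_norm[OF t(1)] veronese_form_simps,
            rule arg_cong2[of _ _ _ _ "(/)", OF _ refl])
          (simp add: poly_simps)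
    qed
  next
    case 3
    show ?thesis
      unfolding \<open>k = 3\<close>
    \<comment> \<open>The denominator 2 moves into \<open>P\<close>. With
      \<open>s = x\<^sup>2 + y\<^sup>2\<close> this is \<open>P = - (s\<^sup>2 - 2 * s) / 2\<close>,
      hence \<open>dP = (1 - s) ds\<close>.\<close>
    proof (rule is_primitive_over_square[where
          P = "\<lambda>x y. - ((x\<^sup>2 + y\<^sup>2) * (x\<^sup>2 + y\<^sup>2 - 2) / 2)" and
          P' = "\<lambda>x y a b. 2 * (x * a + y * b) * (1 - (x\<^sup>2 + y\<^sup>2))"], goal_cases)
      case 1
      show ?case by (simp add: veronese_surface_def t(2))
    next
      case 2
      show ?case by (auto intro!: derivative_eq_intros simp: fun_eq_iff poly_simps)
    next
      case 3
      show ?case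
        by (simp only: veronese_norm[OF t(1)] veronese_form_simps,
            rule arg_cong2[of _ _ _ _ "(/)", OF _ refl])
          (simp add: poly_simps)
    qed
  next
    case 4
    show ?thesis
      unfolding \<open>k = 4\<close>
    \<comment> \<open>Similarly \<open>dP = - sqrt 3 * (s + 1) ds\<close>; the factor
      \<open>sqrt 3\<close> is common to both sides.\<close>
    proof (rule is_primitive_over_square[where
          P = "\<lambda>x y. - (sqrt 3 * ((x\<^sup>2 + y\<^sup>2) * (x\<^sup>2 + y\<^sup>2 + 2) / 2))" and
          P' = "\<lambda>x y a b. - (sqrt 3 * (2 * (x * a + y * b) * (x\<^sup>2 + y\<^sup>2 + 1)))"], goal_cases)
      case 1
      show ?case by (simp add: veronese_surface_def t(2))
    next
      case 2
      show ?case by (auto intro!: derivative_eq_intros simp: fun_eq_iff poly_simps)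
    next
      case 3
      show ?case
        by (simp only: veronese_norm[OF t(1)] veronese_form_simps,
            rule arg_cong2[of _ _ _ _ "(/)", OF _ refl])
          (simp add: poly_simps)
    qed
  next
    case 5
    show ?thesis
      unfolding \<open>k = 5\<close>
    proof (rule is_primitive_over_square[where
          P = "\<lambda>x y. t * y" and
          P' = "\<lambda>x y a b. t * b"], goal_cases)
      case 1
      show ?case by (simp add: veronese_surface_def t(2))
    next
      case 2
      show ?case by (auto intro!: derivative_eq_intros simp: fun_eq_iff poly_simps)
    next
      case 3
      show ?case
        by (simp only: veronese_norm[OF t(1)] veronese_form_simps,
            rule arg_cong2[of _ _ _ _ "(/)", OF _ refl])
          (simp add: poly_simps)
    qed
  next
    case 6
    show ?thesis
      unfolding \<open>k = 6\<close>
    proof (rule is_primitive_over_square[where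
          P = "\<lambda>x y. 2 * x * y" and
          P' = "\<lambda>x y a b. 2 * (a * y + x * b)"], goal_cases)
      case 1
      show ?case by (simp add: veronese_surface_def t(2))
    next
      case 2
      show ?case by (auto intro!: derivative_eq_intros simp: fun_eq_iff poly_simps)
    next
      case 3
      show ?case
        by (simp only: veronese_norm[OF t(1)] veronese_form_simps,
            rule arg_cong2[of _ _ _ _ "(/)", OF _ refl])
          (simp add: poly_simps)
    qed
  next
    case 7
    show ?thesis
      unfolding \<open>k = 7\<close>
    proof (rule is_primitive_over_square[where
          P = "\<lambda>x y. - (t * x)" and
          P' = "\<lambda>x y a b. - (t * a)"], goal_cases)
      case 1
      show ?case by (simp add: veronese_surface_def t(2))
    next
      case 2
      show ?case by (auto intro!: derivative_eq_intros simp: fun_eq_iff poly_simps)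
    next
      case 3
      show ?case
        by (simp only: veronese_norm[OF t(1)] veronese_form_simps,
            rule arg_cong2[of _ _ _ _ "(/)", OF _ refl])
          (simp add: poly_simps)
    qed
  next
    case 8
    show ?thesis
      unfolding \<open>k = 8\<close>
    proof (rule is_primitive_over_square[where
          P = "\<lambda>x y. - x\<^sup>2 + y\<^sup>2" and
          P' = "\<lambda>x y a b. 2 * (y * b - x * a)"], goal_cases)
      case 1
      show ?case by (simp add: veronese_surface_def t(2))
    next
      case 2
      show ?case by (auto intro!: derivative_eq_intros simp: fun_eq_iff poly_simps)
    next
      case 3
      show ?case
        by (simp only: veronese_norm[OF t(1)] veronese_form_simps,
            rule arg_cong2[of _ _ _ _ "(/)", OF _ refl])
          (simp add: poly_simps)
    qed
  qed
qed

section \<open>The quadratic relation between the components\<close>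

text \<open>Over the common denominator \<open>d ^ 4\<close>, the numerators combine to a polynomial
  in \<open>s\<close> alone, since \<open>4 * x\<^sup>2 * y\<^sup>2 + (y\<^sup>2 -
  x\<^sup>2)\<^sup>2 = s\<^sup>2\<close>; with \<open>d = 1 + s\<close> it vanishes.\<close>

lemma veronese_surface_quadric:
  "4 * (veronese_surface 1 x y)\<^sup>2 + 4 * (veronese_surface 2 x y)\<^sup>2 + 4 * (veronese_surface 3 x y)\<^sup>2
    + 2 / sqrt 3 * veronese_surface 4 x y + (veronese_surface 5 x y)\<^sup>2 + (veronese_surface 6 x y)\<^sup>2
    + (veronese_surface 7 x y)\<^sup>2 + (veronese_surface 8 x y)\<^sup>2 = 0"
proof -
  define d where "d = 1 + x\<^sup>2 + y\<^sup>2"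
  have d: "d \<noteq> 0"
    unfolding d_def using add_pos_nonneg[of 1 "x\<^sup>2 + y\<^sup>2"] by (simp add: add.assoc)
  define s where "s = x\<^sup>2 + y\<^sup>2"
  have X1: "4 * (veronese_surface 1 x y)\<^sup>2 = 8 * x\<^sup>2 * s\<^sup>2 / d ^ 4"
    and X2: "4 * (veronese_surface 2 x y)\<^sup>2 = 8 * y\<^sup>2 * s\<^sup>2 / d ^ 4"
    and X3: "4 * (veronese_surface 3 x y)\<^sup>2 = s\<^sup>2 * (s - 2)\<^sup>2 / d ^ 4"
    and X5: "(veronese_surface 5 x y)\<^sup>2 = 2 * y\<^sup>2 / d ^ 4"
    and X6: "(veronese_surface 6 x y)\<^sup>2 = 4 * x\<^sup>2 * y\<^sup>2 / d ^ 4"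
    and X7: "(veronese_surface 7 x y)\<^sup>2 = 2 * x\<^sup>2 / d ^ 4"
    and X8: "(veronese_surface 8 x y)\<^sup>2 = (y\<^sup>2 - x\<^sup>2)\<^sup>2 / d ^ 4"
    by (simp_all add: veronese_surface_def s_def d_def power_mult_distrib power_divide
        flip: power_mult)
  have "2 / sqrt 3 * veronese_surface 4 x y = - (s * (s + 2) / d\<^sup>2)"
    by (simp add: veronese_surface_def s_def d_def)
  \<comment> \<open>The fourth component enters linearly, so its fraction is expanded by
    \<open>d\<^sup>2\<close> to match the squares.\<close>
  also have "\<dots> = - (s * (s + 2) * d\<^sup>2 / d ^ 4)"
    using d by (simp add: eval_nat_numeral)
  finally have X4: "2 / sqrt 3 * veronese_surface 4 x y = - (s * (s + 2) * d\<^sup>2 / d ^ 4)" .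
  have "8 * x\<^sup>2 * s\<^sup>2 + 8 * y\<^sup>2 * s\<^sup>2 + s\<^sup>2 * (s - 2)\<^sup>2 - s * (s + 2) * d\<^sup>2 + 2 * y\<^sup>2 + 4 * x\<^sup>2 * y\<^sup>2
      + 2 * x\<^sup>2 + (y\<^sup>2 - x\<^sup>2)\<^sup>2 = 0"
    unfolding s_def d_def by algebra
  then show ?thesis
    unfolding X1 X2 X3 X4 X5 X6 X7 X8
    by (simp only: add_divide_distrib[symmetric] diff_divide_distrib[symmetric]
        add_uminus_conv_diff div_0)
qed

text \<open>Integration up to additive constants is stated as an equivalence, which describes all
  primitives of each form.\<close>

theorem mainTheorem5:
  fixes w1 w2 :: "complex \<Rightarrow> complex" and X :: "nat \<Rightarrow> real \<Rightarrow> real \<Rightarrow> real"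
  assumes w1: "w1 = (\<lambda>\<xi>. complex_of_real (sqrt 2) * \<xi>)"
    and w2: "w2 = (\<lambda>\<xi>. \<xi>\<^sup>2)"
    and X: "X = veronese_surface"
  shows "(\<forall>k\<in>{1..8}. \<forall>Y :: complex \<Rightarrow> real.
            is_primitive (weierstrass_form w1 w2 k) Y \<longleftrightarrow>
            (\<exists>c. \<forall>x y. Y (Complex x y) = X k x y + c))
       \<and> (\<forall>x y. 4 * (X 1 x y)\<^sup>2 + 4 * (X 2 x y)\<^sup>2 + 4 * (X 3 x y)\<^sup>2 + 2 / sqrt 3 * X 4 x y
            + (X 5 x y)\<^sup>2 + (X 6 x y)\<^sup>2 + (X 7 x y)\<^sup>2 + (X 8 x y)\<^sup>2 = 0)"
proof (intro conjI ballI allI)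
  fix k :: nat and Y :: "complex \<Rightarrow> real"
  assume k: "k \<in> {1..8}"
  have "is_primitive (weierstrass_form w1 w2 k) Y
      \<longleftrightarrow> (\<exists>c. \<forall>\<xi>. Y \<xi> = veronese_surface k (Re \<xi>) (Im \<xi>) + c)"
    \<comment> \<open>Here \<open>refl\<close> instantiates \<open>t\<close> to
      \<open>sqrt 2\<close>, and \<open>simp\<close> proves the remaining
      \<open>sqrt 2 * sqrt 2 = 2\<close>.\<close>
    unfolding w1 w2 by (rule is_primitive_unique[OF veronese_primitive[OF _ refl k]]) simp
  also have "\<dots> \<longleftrightarrow> (\<exists>c. \<forall>x y. Y (Complex x y) = X k x y + c)"
    unfolding X by (metis complex.collapse complex.sel)
  finally show "is_primitive (weierstrass_form w1 w2 k) Y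
      \<longleftrightarrow> (\<exists>c. \<forall>x y. Y (Complex x y) = X k x y + c)" .
next
  fix x y :: real
  show "4 * (X 1 x y)\<^sup>2 + 4 * (X 2 x y)\<^sup>2 + 4 * (X 3 x y)\<^sup>2 + 2 / sqrt 3 * X 4 x y
            + (X 5 x y)\<^sup>2 + (X 6 x y)\<^sup>2 + (X 7 x y)\<^sup>2 + (X 8 x y)\<^sup>2 = 0"
    unfolding X by (rule veronese_surface_quadric)
qed

end
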